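(* For $i\in[n-1]$ let $s_i=(i,i+1)$ be the simple transposition in $S_n$. Let $\tau,\tau'\in S_n$ be such that $\tau\leq_B\tau'$, where $\tau'=\tau s_{i_1}\cdots s_{i_m}$ for some $i_1,\dots,i_m\in[n-1]$, and let $\mathfrak B,\mathfrak B'$ be the flags of bases of the uniform flag matroid $\mathfrak U_n=(U_{0,n},\dots,U_{n,n})$ whose Bruhat permutations are $\tau$ and $\tau'$, respectively. If the $s_{i_j}$ commute pairwise, then the interval $[\mathfrak B',\mathfrak B]_G$ constitutes the set of flags of bases of a (full) lattice path flag matroid on $[n]$.
   Context: $[n]=\{1,\dots,n\}$; $U_{k,n}$ is the uniform matroid of rank $k$ on $[n]$. For $A=\{a_1<\dots<a_k\}$, $B=\{b_1<\dots<b_k\}$ in $\binom{[n]}{k}$, $A\leq_G B$ (Gale order) iff $a_i\leq b_i$ for all $i$. A flag of bases of $\mathfrak U_n$ is a chain $\mathfrak B=(B_0\subseteq B_1\subseteq\dots\subseteq B_n)$ with $B_i\in\binom{[n]}{i}$; $\mathfrak B\leq_G\mathfrak B'$ iff $B_i\leq_G B_i'$ for all $i$, and $[\mathfrak B',\mathfrak B]_G$ is the set of flags $\mathfrak C$ of bases of $\mathfrak U_n$ with $\mathfrak B'\leq_G\mathfrak C\leq_G\mathfrak B$. The Gale permutation $\pi=\pi_{\mathfrak B}\in S_n$ of $\mathfrak B$ is given by $\{\pi(i)\}=B_i\setminus B_{i-1}$. The Bruhat permutation of $\mathfrak B$ is $\tau_{\mathfrak B}=\overline\pi^{-1}$ where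 $\overline\pi(i)=\pi(n-i+1)$. The assignment $\mathfrak B\mapsto\tau_{\mathfrak B}$ is a bijection from flags of bases of $\mathfrak U_n$ to $S_n$. Strong Bruhat order $\leq_B$ on $S_n$: $v$ covers $u$ if $v=u\circ(i,j)$ for some $i<j$ with $u(i)<u(j)$ such that for all $i<k<j$ one has $u(k)<u(i)$ or $u(k)>u(j)$; $\leq_B$ is the reflexive and transitive closure. Products of permutations are compositions, so $\tau s_i$ is $\tau$ with the values in positions $i,i+1$ exchanged. For $U\leq_G L$ in $\binom{[n]}{k}$, the lattice path matroid (LPM) $M[U,L]$ is the matroid on $[n]$ with set of bases $\{B\in\binom{[n]}{k}: U\leq_G B\leq_G L\}$. For matroids $M,M'$ on $[n]$ with sets of bases $\mathcal B,\mathcal B'$, $M'\leq_Q M$ ($M'$ is a quotient of $M$) if for all $B\in\mathcal B$ and $p\in[n]\setminus B$ there is $B'\in\mathcal B'$ with $B'\subseteq B$ such that for all $q\in B'$: if $(B'\cup\{p\})\setminus\{q\}\in\mathcal B'$ then $(B\cup\{p\})\setminus\{q\}\in\mathcal B$. A (full) lattice path flag matroid (LPFM) on $[n]$ is a sequence $(M_0,\dots,M_n)$ of distinct LPMs on $[n]$ with $M_i\leq_Q M_{i+1}$ for $0\leq i\leq n-1$ (so $M_i$ has rank $i$); its flags of bases are the chains $B_0\subseteq\dots\subseteq B_n$ with $B_i$ a basis of $M_i$. *)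

theory Defs
  imports "HOL-Combinatorics.Combinatorics"
begin

text \<open>
  A matroid on \<open>[n] = {1..n}\<close> is represented by its set of bases. Flags are lists with indices
  \<open>0, \<dots>, n\<close>, and permutations of \<open>[n]\<close> are functions \<open>p\<close> with \<open>p permutes {1..n}\<close>.
\<close>

type_synonym matroid = "nat set set"


text \<open>Comparing the sorted lists pointwise also forces equal cardinality (for finite sets).\<close>

definition gale_le :: "nat set \<Rightarrow> nat set \<Rightarrow> bool" where
  "gale_le A B \<longleftrightarrow> list_all2 (\<le>) (sorted_list_of_set A) (sorted_list_of_set B)"

definition uniform :: "nat \<Rightarrow> nat \<Rightarrow> matroid" where
  "uniform k n = {B. B \<subseteq> {1..n} \<and> card B = k}"

definition uniform_flag :: "nat \<Rightarrow> matroid list" where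
  "uniform_flag n = map (\<lambda>k. uniform k n) [0..<n + 1]"

definition flags_of_bases :: "matroid list \<Rightarrow> nat set list set" where
  "flags_of_bases Ms = {Bs. list_all2 (\<in>) Bs Ms \<and> successively (\<subseteq>) Bs}"

definition gale_flag_le :: "nat set list \<Rightarrow> nat set list \<Rightarrow> bool" where
  "gale_flag_le Bs Cs \<longleftrightarrow> list_all2 gale_le Bs Cs"

definition gale_interval :: "nat \<Rightarrow> nat set list \<Rightarrow> nat set list \<Rightarrow> nat set list set" where
  "gale_interval n Bs' Bs =
     {Cs \<in> flags_of_bases (uniform_flag n). gale_flag_le Bs' Cs \<and> gale_flag_le Cs Bs}"


definition gale_perm :: "nat \<Rightarrow> nat set list \<Rightarrow> nat \<Rightarrow> nat" where
  "gale_perm n Bs i = (if i \<in> {1..n} then the_elem (Bs ! i - Bs ! (i - 1)) else i)"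

definition reversal :: "nat \<Rightarrow> nat \<Rightarrow> nat" where
  "reversal n i = (if i \<in> {1..n} then n - i + 1 else i)"

definition bruhat_perm :: "nat \<Rightarrow> nat set list \<Rightarrow> nat \<Rightarrow> nat" where
  "bruhat_perm n Bs = inv (gale_perm n Bs \<circ> reversal n)"

text \<open>\<open>bruhat_cover n u v\<close> means that \<open>v\<close> covers \<open>u\<close>.\<close>

definition bruhat_cover :: "nat \<Rightarrow> (nat \<Rightarrow> nat) \<Rightarrow> (nat \<Rightarrow> nat) \<Rightarrow> bool" where
  "bruhat_cover n u v \<longleftrightarrow>
     (\<exists>i\<in>{1..n}. \<exists>j\<in>{1..n}. i < j \<and> u i < u j \<and>
        (\<forall>k. i < k \<and> k < j \<longrightarrow> u k < u i \<or> u k > u j) \<and>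
        v = u \<circ> transpose i j)"

definition bruhat_le :: "nat \<Rightarrow> (nat \<Rightarrow> nat) \<Rightarrow> (nat \<Rightarrow> nat) \<Rightarrow> bool" where
  "bruhat_le n = (bruhat_cover n)\<^sup>*\<^sup>*"

definition simple_transp :: "nat \<Rightarrow> nat \<Rightarrow> nat" where
  "simple_transp i = transpose i (i + 1)"


definition lpm :: "nat \<Rightarrow> nat \<Rightarrow> nat set \<Rightarrow> nat set \<Rightarrow> matroid" where
  "lpm k n U L = {B \<in> uniform k n. gale_le U B \<and> gale_le B L}"

definition is_lpm :: "nat \<Rightarrow> matroid \<Rightarrow> bool" where
  "is_lpm n M \<longleftrightarrow>
     (\<exists>k. \<exists>U\<in>uniform k n. \<exists>L\<in>uniform k n. gale_le U L \<and> M = lpm k n U L)"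

text \<open>\<open>quotient_of n M' M\<close> means that \<open>M'\<close> is a quotient of \<open>M\<close>.\<close>

definition quotient_of :: "nat \<Rightarrow> matroid \<Rightarrow> matroid \<Rightarrow> bool" where
  "quotient_of n M' M \<longleftrightarrow>
     (\<forall>B\<in>M. \<forall>p\<in>{1..n} - B. \<exists>B'\<in>M'. B' \<subseteq> B \<and>
        (\<forall>q\<in>B'. (B' \<union> {p}) - {q} \<in> M' \<longrightarrow> (B \<union> {p}) - {q} \<in> M))"

definition is_lpfm :: "nat \<Rightarrow> matroid list \<Rightarrow> bool" where
  "is_lpfm n Ms \<longleftrightarrow> length Ms = n + 1 \<and> distinct Ms \<and> (\<forall>M\<in>set Ms. is_lpm n M) \<and>
     successively (quotient_of n) Ms"

end

theory Submission
  imports Defs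
begin

text \<open>
  Right multiplication by \<open>s\<^sub>i\<close> exchanges the moments at which the elements \<open>i\<close> and \<open>i + 1\<close> enter the
  flag. Since the transpositions commute, no two of them are neighbours, so after cancelling
  repetitions \<open>\<tau>'\<close> arises from \<open>\<tau>\<close> by exchanging the members of disjoint pairs \<open>{t, t + 1}\<close>, with \<open>t\<close> in
  some set \<open>S\<close>. Write \<open>B\<^sub>k\<close> and \<open>B'\<^sub>k\<close> for the members of the two flags. Then \<open>B'\<^sub>k\<close> is obtained from
  \<open>B\<^sub>k\<close> by the same exchange, and for \<open>t \<notin> S\<close> both sets contain equally many elements up to \<open>t\<close>.

  Prefix sums of values grow along the Bruhat order. Applied to the prefix ending at \<open>t \<in> S\<close> this gives
  \<open>\<tau> t < \<tau> (t + 1)\<close>: in the flag of \<open>\<tau>\<close> the element \<open>t + 1\<close> enters before \<open>t\<close>. Among all sets with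
  prescribed prefix counts outside \<open>S\<close>, \<open>B\<^sub>k\<close> therefore has the smallest possible count at each
  \<open>t \<in> S\<close>, and \<open>B'\<^sub>k\<close> the largest. As the Gale order compares prefix counts
  (\<open>gale_le_iff_card_prefix\<close>), the lattice path matroid \<open>M\<^sub>k = M[B'\<^sub>k, B\<^sub>k]\<close> consists of all
  sets with the same prefix counts as \<open>B\<^sub>k\<close> outside \<open>S\<close> (\<open>lpm_eq_prefix_class\<close>).

  This description no longer mentions the order: the positions outside \<open>S\<close> cut \<open>[n]\<close> into blocks, and
  \<open>M\<^sub>k\<close> prescribes how many elements a basis has in each block. Passing from \<open>k\<close> to \<open>k + 1\<close> raises one
  of these numbers by one. Two such partition matroids form a quotient, because an exchange of \<open>q\<close>
  for \<open>p\<close> preserves a basis exactly if \<open>p\<close> and \<open>q\<close> share a block, a condition that does not depend on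
  \<open>k\<close> (\<open>prefix_class_quotient\<close>). The flags of bases of \<open>M\<^sub>0, \<dots>, M\<^sub>n\<close> are those in the Gale
  interval, because the Gale order on flags is componentwise.
\<close>

section \<open>The Gale order through prefix counts\<close>

text \<open>
  Prefix counts of a set and its sorted list determine each other, which is what translates the
  positionwise Gale order into an order on prefix counts.
\<close>

lemma card_prefix_conv_sorted_list:
  fixes A :: "nat set"
  assumes "finite A"
  shows "card (A \<inter> {..t}) = card {j. j < card A \<and> sorted_list_of_set A ! j \<le> t}"
proof -
  let ?l = "sorted_list_of_set A"
  have "distinct ?l" "length ?l = card A" "set ?l = A"
    using assms by auto
  then have "inj_on ((!) ?l) {j. j < card A \<and> ?l ! j \<le> t}"
    and "(!) ?l ` {j. j < card A \<and> ?l ! j \<le> t} = A \<inter> {..t}"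
    by (auto simp: inj_on_def nth_eq_iff_index_eq in_set_conv_nth image_iff set_eq_iff)
      (metis in_set_conv_nth)+
  then show ?thesis
    by (metis card_image)
qed

text \<open>
  The direction of the inequality reverses: a Gale-smaller set has its elements further to the left,
  hence more of them in every prefix.
\<close>

lemma gale_le_iff_card_prefix:
  assumes "finite A" and "finite B"
  shows "gale_le A B \<longleftrightarrow>
    card A = card B \<and> (\<forall>t. card (B \<inter> {..t}) \<le> card (A \<inter> {..t}))"
proof (intro iffI conjI allI)
  assume "gale_le A B"
  then have len: "card A = card B"
    and le: "\<And>j. j < card A \<Longrightarrow> sorted_list_of_set A ! j \<le> sorted_list_of_set B ! j"
    by (auto simp: gale_le_def list_all2_conv_all_nth)
  from len show "card A = card B" .
  fix t
  show "card (B \<inter> {..t}) \<le> card (A \<inter> {..t})"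
    unfolding card_prefix_conv_sorted_list[OF assms(1)] card_prefix_conv_sorted_list[OF assms(2)]
    using le by (intro card_mono) (auto simp: len intro: order_trans)
next
  assume asm: "card A = card B \<and> (\<forall>t. card (B \<inter> {..t}) \<le> card (A \<inter> {..t}))"
  let ?a = "sorted_list_of_set A" and ?b = "sorted_list_of_set B"
  have "?a ! j \<le> ?b ! j" if j: "j < card A" for j
  proof (rule ccontr)
    assume gt: "\<not> ?a ! j \<le> ?b ! j"
    have "Suc j = card {..j}" by simp
    also have "\<dots> \<le> card {i. i < card B \<and> ?b ! i \<le> ?b ! j}"
      using j asm by (intro card_mono) (auto intro!: sorted_nth_mono)
    also have "\<dots> \<le> card {i. i < card A \<and> ?a ! i \<le> ?b ! j}"
      using asm card_prefix_conv_sorted_list assms by metis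
    also have "\<dots> \<le> card {..<j}"
    proof (rule card_mono)
      show "{i. i < card A \<and> ?a ! i \<le> ?b ! j} \<subseteq> {..<j}"
      proof clarsimp
        fix i assume i: "i < card A" "?a ! i \<le> ?b ! j"
        show "i < j"
        proof (rule ccontr)
          assume "\<not> i < j"
          then have "?a ! j \<le> ?a ! i"
            using i assms by (intro sorted_nth_mono) auto
          with i gt show False by linarith
        qed
      qed
    qed simp
    finally show False by simp
  qed
  then show "gale_le A B"
    using asm by (simp add: gale_le_def list_all2_conv_all_nth)
qed

lemma card_prefix_Suc:
  fixes A :: "nat set"
  shows "card (A \<inter> {..Suc t}) = card (A \<inter> {..t}) + (if Suc t \<in> A then 1 else 0)"
  by (auto simp: atMost_Suc Int_insert_right)

section \<open>Prefix count classes\<close>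

text \<open>
  The bases of the partition matroid on \<open>[n]\<close> whose blocks are the segments between consecutive
  positions outside \<open>S\<close> and whose block sizes are those of \<open>A\<close>. Counting in prefixes instead of
  blocks matches the description of the Gale order above.
\<close>

definition prefix_class :: "nat \<Rightarrow> nat set \<Rightarrow> nat set \<Rightarrow> nat set set" where
  "prefix_class n S A =
     {C. C \<subseteq> {1..n} \<and> (\<forall>t. t \<notin> S \<longrightarrow> card (C \<inter> {..t}) = card (A \<inter> {..t}))}"

text \<open>
  At a position \<open>t \<in> S\<close> the counts at \<open>t - 1\<close> and \<open>t + 1\<close> are prescribed, since neither neighbour lies
  in \<open>S\<close>. They leave at most two values for the count at \<open>t\<close>. A set that prefers \<open>t + 1\<close> to \<open>t\<close>, as \<open>L\<close>
  does, attains the smaller one, and a set that prefers \<open>t\<close>, as \<open>U\<close> does, the larger one. So the Gale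
  conditions at \<open>t\<close> hold automatically.
\<close>

lemma lpm_eq_prefix_class:
  assumes S: "\<And>t. t \<in> S \<Longrightarrow> 0 < t \<and> t < n \<and> Suc t \<notin> S"
    and U: "U \<in> uniform k n" and L: "L \<in> uniform k n"
    and agree: "\<And>t. t \<notin> S \<Longrightarrow> card (U \<inter> {..t}) = card (L \<inter> {..t})"
    and L_late: "\<And>t. t \<in> S \<Longrightarrow> t \<in> L \<Longrightarrow> Suc t \<in> L"
    and U_early: "\<And>t. t \<in> S \<Longrightarrow> Suc t \<in> U \<Longrightarrow> t \<in> U"
  shows "lpm k n U L = prefix_class n S L"
proof (intro set_eqI iffI)
  fix C
  have fin: "finite U" "finite L" and card: "card U = k" "card L = k"
    using U L by (auto simp: uniform_def intro: finite_subset)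
  {
    assume C: "C \<in> lpm k n U L"
    then have sub: "C \<subseteq> {1..n}" by (auto simp: lpm_def uniform_def)
    then have "finite C" by (rule finite_subset) simp
    with C fin have "card (C \<inter> {..t}) \<le> card (U \<inter> {..t}) \<and> card (L \<inter> {..t}) \<le> card (C \<inter> {..t})"
      for t by (auto simp: lpm_def gale_le_iff_card_prefix)
    then have "card (C \<inter> {..t}) = card (L \<inter> {..t})" if "t \<notin> S" for t
      using agree[OF that] by (metis le_antisym)
    with sub show "C \<in> prefix_class n S L" by (simp add: prefix_class_def)
  next
    assume C: "C \<in> prefix_class n S L"
    then have sub: "C \<subseteq> {1..n}" and eq: "\<And>t. t \<notin> S \<Longrightarrow> card (C \<inter> {..t}) = card (L \<inter> {..t})"
      by (auto simp: prefix_class_def)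
    from sub have finC: "finite C" by (rule finite_subset) simp
    \<comment> \<open>The position \<open>n\<close> is never in \<open>S\<close>, so its count fixes the size of \<open>C\<close>.\<close>
    have "C \<inter> {..n} = C" "L \<inter> {..n} = L" "n \<notin> S"
      using sub L S[of n] by (auto simp: uniform_def)
    with eq[of n] card have cardC: "card C = k" by simp
    have bounds: "card (L \<inter> {..t}) \<le> card (C \<inter> {..t}) \<and> card (C \<inter> {..t}) \<le> card (U \<inter> {..t})" for t
    proof (cases "t \<in> S")
      case False
      then show ?thesis using eq agree by simp
    next
      case True
      then obtain r where r: "t = Suc r" using S[OF True] by (cases t) auto
      have "r \<notin> S" "Suc t \<notin> S" using S True r by auto
      then have eqs:
        "card (C \<inter> {..r}) = card (L \<inter> {..r})" "card (U \<inter> {..r}) = card (L \<inter> {..r})"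
        "card (C \<inter> {..Suc t}) = card (L \<inter> {..Suc t})"
        "card (U \<inter> {..Suc t}) = card (L \<inter> {..Suc t})"
        using eq agree by blast+
      have step: "card (X \<inter> {..t}) = card (X \<inter> {..r}) + (if t \<in> X then 1 else 0)"
        "card (X \<inter> {..Suc t}) = card (X \<inter> {..t}) + (if Suc t \<in> X then 1 else 0)" for X
        unfolding r by (rule card_prefix_Suc)+
      have incr: "card (X \<inter> {..r}) \<le> card (X \<inter> {..t})" "card (X \<inter> {..t}) \<le> card (X \<inter> {..r}) + 1"
        "card (X \<inter> {..t}) \<le> card (X \<inter> {..Suc t})" "card (X \<inter> {..Suc t}) \<le> card (X \<inter> {..t}) + 1" for X
        unfolding step(2) by (simp_all add: step(1))
      have "card (L \<inter> {..t}) \<le> card (C \<inter> {..t})"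
      proof (cases "t \<in> L")
        case True
        then have "card (L \<inter> {..Suc t}) = card (L \<inter> {..t}) + 1"
          using L_late[OF \<open>t \<in> S\<close>] step(2)[of L] by simp
        then show ?thesis
          using eqs(3) incr(4)[of C] by linarith
      next
        case False
        then have "card (L \<inter> {..t}) = card (L \<inter> {..r})" using step(1)[of L] by simp
        then show ?thesis
          using eqs(1) incr(1)[of C] by linarith
      qed
      moreover have "card (C \<inter> {..t}) \<le> card (U \<inter> {..t})"
      proof (cases "t \<in> U")
        case True
        then have "card (U \<inter> {..t}) = card (U \<inter> {..r}) + 1" using step(1)[of U] by simp
        then show ?thesis
          using eqs(1,2) incr(2)[of C] by linarith
      next
        case False
        then have "card (U \<inter> {..Suc t}) = card (U \<inter> {..t})"
          using U_early[OF \<open>t \<in> S\<close>] step(2)[of U] by auto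
        then show ?thesis
          using eqs(3,4) incr(3)[of C] by linarith
      qed
      ultimately show ?thesis ..
    qed
    with sub cardC card fin finC show "C \<in> lpm k n U L"
      by (auto simp: lpm_def uniform_def gale_le_iff_card_prefix)
  }
qed

lemma card_prefix_exchange:
  fixes C :: "nat set"
  assumes "finite C" and "q \<in> C" and "p \<notin> C"
  shows "card ((C \<union> {p} - {q}) \<inter> {..t}) + (if q \<le> t then 1 else 0)
       = card (C \<inter> {..t}) + (if p \<le> t then 1 else 0)"
proof -
  have pq: "(C \<union> {p} - {q}) \<inter> {..t} =
      (if p \<le> t then insert p (C \<inter> {..t} - {q}) else C \<inter> {..t} - {q})"
    using assms by auto
  have "card (C \<inter> {..t} - {q}) + (if q \<le> t then 1 else 0) = card (C \<inter> {..t})"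
    using card_Suc_Diff1[of "C \<inter> {..t}" q] assms by auto
  then show ?thesis
    unfolding pq using assms by auto
qed

text \<open>
  The right-hand side says that \<open>p\<close> and \<open>q\<close> lie in the same block. It mentions neither \<open>C\<close> nor \<open>A\<close>,
  so exchanges can be transported between classes with different block sizes.
\<close>

lemma prefix_class_exchange_iff:
  assumes C: "C \<in> prefix_class n S A" and "q \<in> C" and "p \<in> {1..n} - C"
  shows "C \<union> {p} - {q} \<in> prefix_class n S A \<longleftrightarrow> (\<forall>t. t \<notin> S \<longrightarrow> (p \<le> t \<longleftrightarrow> q \<le> t))"
proof -
  have sub: "C \<subseteq> {1..n}" and eq: "\<And>t. t \<notin> S \<Longrightarrow> card (C \<inter> {..t}) = card (A \<inter> {..t})"
    using C by (auto simp: prefix_class_def)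
  have "finite C" using sub by (rule finite_subset) simp
  note ex = card_prefix_exchange[OF this \<open>q \<in> C\<close>, of p]
  have "card ((C \<union> {p} - {q}) \<inter> {..t}) = card (A \<inter> {..t}) \<longleftrightarrow> (p \<le> t \<longleftrightarrow> q \<le> t)"
    if "t \<notin> S" for t
    using ex[of t] eq[OF that] assms(3) by (auto split: if_splits)
  then show ?thesis
    using sub assms(3) by (auto simp: prefix_class_def)
qed

text \<open>
  Sets with equal prefix counts outside \<open>S\<close> meet each block \<open>{a<..b}\<close> in equally many elements, so \<open>C\<close>
  meets the block of \<open>x\<close> as well. The assumptions on \<open>S\<close> and \<open>x\<close> ensure that this block has both ends.
\<close>

lemma ex_same_prefixes:
  fixes S A C :: "nat set"
  assumes "finite S" and "0 \<notin> S" and "x \<in> A" and "0 < x"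
    and C: "\<And>t. t \<notin> S \<Longrightarrow> card (C \<inter> {..t}) = card (A \<inter> {..t})"
  obtains y where "y \<in> C" and "\<And>t. t \<notin> S \<Longrightarrow> y \<le> t \<longleftrightarrow> x \<le> t"
proof -
  define a where "a = Max ({..<x} - S)"
  define b where "b = (LEAST b. x \<le> b \<and> b \<notin> S)"
  have a: "a < x" "a \<notin> S" and a_max: "\<And>t. t < x \<Longrightarrow> t \<notin> S \<Longrightarrow> t \<le> a"
  proof -
    have "0 \<in> {..<x} - S" using assms by auto
    then have "a \<in> {..<x} - S" unfolding a_def by (intro Max_in) auto
    then show "a < x" "a \<notin> S" by auto
  qed (auto simp: a_def intro!: Max_ge)
  obtain m where "\<forall>s\<in>S. s < m"
    using \<open>finite S\<close> finite_nat_set_iff_bounded by blast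
  then have "x \<le> x + m \<and> x + m \<notin> S" by fastforce
  then have b: "x \<le> b" "b \<notin> S"
    unfolding b_def by (rule LeastI2, simp)+
  have b_min: "b \<le> t" if "x \<le> t" "t \<notin> S" for t
    unfolding b_def using that by (simp add: Least_le)
  have "A \<inter> {..a} \<subseteq> A \<inter> {..b}" "x \<in> A \<inter> {..b}" "x \<notin> A \<inter> {..a}"
    using a b \<open>x \<in> A\<close> by auto
  then have "A \<inter> {..a} \<subset> A \<inter> {..b}" by blast
  then have "card (A \<inter> {..a}) < card (A \<inter> {..b})"
    by (intro psubset_card_mono) auto
  then have "card (C \<inter> {..a}) < card (C \<inter> {..b})"
    using C a b by simp
  then have "\<not> C \<inter> {..b} \<subseteq> C \<inter> {..a}"
    using card_mono[of "C \<inter> {..a}" "C \<inter> {..b}"] by auto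
  then obtain y where y: "y \<in> C" "a < y" "y \<le> b"
    by (metis IntD1 IntD2 IntI atMost_iff not_le subsetI)
  show thesis
  proof (rule that[OF y(1)])
    fix t assume "t \<notin> S"
    then show "y \<le> t \<longleftrightarrow> x \<le> t"
      using y a_max[of t] b_min[of t] by (cases "x \<le> t") auto
  qed
qed

text \<open>
  A basis \<open>B\<close> of the larger class contains some \<open>y\<close> from the block of the new element \<open>x\<close>, and \<open>B - {y}\<close>
  is then a basis of the smaller class. It witnesses the quotient condition for every \<open>p\<close>.
\<close>

lemma prefix_class_quotient:
  assumes "finite S" and "0 \<notin> S" and "finite A" and "x \<notin> A" and "0 < x"
  shows "quotient_of n (prefix_class n S A) (prefix_class n S (insert x A))"
  unfolding quotient_of_def
proof (intro ballI)
  fix B p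
  assume B: "B \<in> prefix_class n S (insert x A)" and p: "p \<in> {1..n} - B"
  then have sub: "B \<subseteq> {1..n}"
    and cnt: "\<And>t. t \<notin> S \<Longrightarrow> card (B \<inter> {..t}) = card (insert x A \<inter> {..t})"
    by (auto simp: prefix_class_def)
  from sub have fin: "finite B" by (rule finite_subset) simp
  obtain y where y: "y \<in> B" and same: "\<And>t. t \<notin> S \<Longrightarrow> y \<le> t \<longleftrightarrow> x \<le> t"
    using ex_same_prefixes[OF assms(1,2) insertI1 \<open>0 < x\<close> cnt] by blast
  have cls: "B - {y} \<in> prefix_class n S A"
  proof -
    have "card ((B - {y}) \<inter> {..t}) = card (A \<inter> {..t})" if t: "t \<notin> S" for t
    proof -
      have "(B - {y}) \<inter> {..t} = B \<inter> {..t} - {y}" by auto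
      then show ?thesis
        using cnt[OF t] same[OF t] y fin \<open>finite A\<close> \<open>x \<notin> A\<close>
        by (auto simp: Int_insert_left card_Diff_singleton_if)
    qed
    with sub show ?thesis by (auto simp: prefix_class_def)
  qed
  show "\<exists>B'\<in>prefix_class n S A. B' \<subseteq> B \<and> (\<forall>q\<in>B'.
      B' \<union> {p} - {q} \<in> prefix_class n S A \<longrightarrow> B \<union> {p} - {q} \<in> prefix_class n S (insert x A))"
  proof (intro bexI[OF _ cls] conjI ballI impI)
    fix q assume q: "q \<in> B - {y}" "B - {y} \<union> {p} - {q} \<in> prefix_class n S A"
    then have "\<forall>t. t \<notin> S \<longrightarrow> (p \<le> t \<longleftrightarrow> q \<le> t)"
      using prefix_class_exchange_iff[OF cls] p by blast
    then show "B \<union> {p} - {q} \<in> prefix_class n S (insert x A)"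
      using prefix_class_exchange_iff[OF B] q p by blast
  qed auto
qed

section \<open>Flags of bases and their Bruhat permutations\<close>

lemma uniform_flagD:
  assumes "Bs \<in> flags_of_bases (uniform_flag n)"
  shows "length Bs = Suc n"
    and "k \<le> n \<Longrightarrow> Bs ! k \<in> uniform k n"
    and "k < n \<Longrightarrow> Bs ! k \<subseteq> Bs ! Suc k"
    and "j \<le> k \<Longrightarrow> k \<le> n \<Longrightarrow> Bs ! j \<subseteq> Bs ! k"
proof -
  have Bs: "list_all2 (\<in>) Bs (uniform_flag n)" "successively (\<subseteq>) Bs"
    using assms by (auto simp: flags_of_bases_def)
  from Bs(1) show len: "length Bs = Suc n"
    by (auto simp: uniform_flag_def dest: list_all2_lengthD)
  show "k \<le> n \<Longrightarrow> Bs ! k \<in> uniform k n"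
    using Bs(1) len list_all2_nthD[of "(\<in>)" Bs "uniform_flag n" k]
    by (auto simp: uniform_flag_def simp del: upt_Suc)
  show "k < n \<Longrightarrow> Bs ! k \<subseteq> Bs ! Suc k"
    using Bs(2) len by (auto simp: successively_conv_nth)
  have "sorted_wrt (\<subseteq>) Bs"
    using Bs(2) by (metis successively_iff_sorted_wrt_strong subset_trans)
  then show "j \<le> k \<Longrightarrow> k \<le> n \<Longrightarrow> Bs ! j \<subseteq> Bs ! k"
    using len sorted_wrt_nth_less[of "(\<subseteq>)" Bs j k] by (cases "j = k") auto
qed

lemma uniform_flag_step:
  assumes "Bs \<in> flags_of_bases (uniform_flag n)" and "k < n"
  obtains x where "x \<in> {1..n}" and "x \<notin> Bs ! k" and "Bs ! Suc k = insert x (Bs ! k)"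
proof -
  note Bs = uniform_flagD[OF assms(1)]
  have u: "Bs ! k \<in> uniform k n" "Bs ! Suc k \<in> uniform (Suc k) n" "Bs ! k \<subseteq> Bs ! Suc k"
    using Bs(2)[of k] Bs(2)[of "Suc k"] Bs(3)[of k] assms(2) by auto
  then have "card (Bs ! Suc k - Bs ! k) = 1"
    by (subst card_Diff_subset) (auto simp: uniform_def intro: finite_subset)
  then obtain x where x: "Bs ! Suc k - Bs ! k = {x}"
    by (auto simp: card_1_singleton_iff)
  then have "x \<in> Bs ! Suc k" by auto
  with u(2) have "x \<in> {1..n}" by (auto simp: uniform_def)
  with x u(3) show thesis by (intro that[of x]) auto
qed

lemma gale_perm_mem_iff:
  assumes Bs: "Bs \<in> flags_of_bases (uniform_flag n)" and j: "j \<in> {1..n}" and "k \<le> n"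
  shows "gale_perm n Bs j \<in> Bs ! k \<longleftrightarrow> j \<le> k"
proof -
  obtain i where i: "j = Suc i" "i < n" using j by (cases j) auto
  obtain x where "x \<notin> Bs ! i" "Bs ! Suc i = insert x (Bs ! i)"
    using uniform_flag_step[OF Bs i(2)] by metis
  moreover from this have "gale_perm n Bs j = x"
    using i by (auto simp: gale_perm_def insert_Diff_if)
  ultimately show ?thesis
    using uniform_flagD(4)[OF Bs, of j k] uniform_flagD(4)[OF Bs, of k i] i \<open>k \<le> n\<close>
    by (cases "j \<le> k") auto
qed

lemma gale_perm_permutes:
  assumes Bs: "Bs \<in> flags_of_bases (uniform_flag n)"
  shows "gale_perm n Bs permutes {1..n}"
proof -
  have "inj_on (gale_perm n Bs) {1..n}"
  proof (rule inj_onI)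
    fix i j assume ij: "i \<in> {1..n}" "j \<in> {1..n}" "gale_perm n Bs i = gale_perm n Bs j"
    then have "i \<le> k \<longleftrightarrow> j \<le> k" if "k \<le> n" for k
      using gale_perm_mem_iff[OF Bs _ that] by metis
    with ij(1,2) show "i = j" by (meson antisym atLeastAtMost_iff order_refl)
  qed
  moreover have "gale_perm n Bs ` {1..n} \<subseteq> {1..n}"
  proof clarify
    fix j assume "j \<in> {1..n}"
    then have "gale_perm n Bs j \<in> Bs ! n"
      using gale_perm_mem_iff[OF Bs, of j n] by auto
    then show "gale_perm n Bs j \<in> {1..n}"
      using uniform_flagD(2)[OF Bs, of n] by (auto simp: uniform_def)
  qed
  ultimately have "bij_betw (gale_perm n Bs) {1..n} {1..n}"
    by (simp add: bij_betw_def endo_inj_surj)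
  then show ?thesis
    by (rule bij_imp_permutes) (auto simp: gale_perm_def)
qed

lemma reversal_permutes: "reversal n permutes {1..n}"
proof (rule bij_imp_permutes)
  show "bij_betw (reversal n) {1..n} {1..n}"
    by (rule bij_betw_byWitness[where f' = "reversal n"]) (auto simp: reversal_def)
qed (auto simp: reversal_def)

text \<open>
  The Bruhat permutation records the step at which \<open>x\<close> enters the flag, counted from the end: \<open>x\<close>
  enters at step \<open>n + 1 - \<tau> x\<close>.
\<close>

lemma flag_mem_iff_bruhat_perm:
  assumes Bs: "Bs \<in> flags_of_bases (uniform_flag n)" and x: "x \<in> {1..n}" and "k \<le> n"
  shows "x \<in> Bs ! k \<longleftrightarrow> n < bruhat_perm n Bs x + k"
proof -
  let ?h = "gale_perm n Bs \<circ> reversal n" and ?y = "bruhat_perm n Bs x"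
  have h: "?h permutes {1..n}"
    using permutes_compose[OF reversal_permutes gale_perm_permutes[OF Bs]] .
  have y: "?y \<in> {1..n}"
    unfolding bruhat_perm_def using permutes_in_image[OF permutes_inv[OF h]] x by simp
  have "?h ?y = x"
    unfolding bruhat_perm_def by (rule permutes_inverses[OF h])
  then have "x \<in> Bs ! k \<longleftrightarrow> gale_perm n Bs (reversal n ?y) \<in> Bs ! k" by simp
  also have "\<dots> \<longleftrightarrow> reversal n ?y \<le> k"
    using y by (intro gale_perm_mem_iff[OF Bs _ \<open>k \<le> n\<close>]) (auto simp: reversal_def)
  finally show ?thesis using y by (auto simp: reversal_def)
qed

section \<open>Bruhat order and commuting simple transpositions\<close>

text \<open>
  A cover moves the larger of two values to the left. The sum over a prefix changes only if the prefix
  separates the two positions, and then it grows.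
\<close>

lemma bruhat_cover_prefix_sum_mono:
  assumes "bruhat_cover n u v"
  shows "(\<Sum>x\<le>p. u x) \<le> (\<Sum>x\<le>p. v x)"
proof -
  obtain i j where ij: "i < j" "u i < u j" and v: "v = u \<circ> transpose i j"
    using assms by (auto simp: bruhat_cover_def)
  show ?thesis
  proof (cases "j \<le> p")
    case True
    then have "transpose i j permutes {..p}"
      using ij by (intro permutes_swap_id) auto
    from sum.permute[OF this, of u] show ?thesis by (simp add: v comp_def)
  next
    case False
    then show ?thesis
      using ij by (intro sum_mono) (auto simp: v transpose_def)
  qed
qed

lemma bruhat_le_prefix_sum_mono:
  assumes "bruhat_le n u v"
  shows "(\<Sum>x\<le>p. u x) \<le> (\<Sum>x\<le>p. v x)"
  using assms unfolding bruhat_le_def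
  by (induction rule: rtranclp_induct) (auto dest: bruhat_cover_prefix_sum_mono intro: order_trans)

text \<open>
  The product of the transpositions \<open>s\<^sub>t\<close> with \<open>t \<in> S\<close>, provided that \<open>S\<close> contains no two consecutive
  numbers.
\<close>

definition adjacent_swaps :: "nat set \<Rightarrow> nat \<Rightarrow> nat" where
  "adjacent_swaps S x = (if x \<in> S then Suc x else if x \<in> Suc ` S then x - 1 else x)"

lemma adjacent_swaps_involution:
  assumes "\<And>t. t \<in> S \<Longrightarrow> Suc t \<notin> S"
  shows "adjacent_swaps S (adjacent_swaps S x) = x"
  using assms by (auto simp: adjacent_swaps_def)

lemma adjacent_swaps_le_iff:
  assumes "\<And>t. t \<in> S \<Longrightarrow> Suc t \<notin> S" and "t \<notin> S"
  shows "adjacent_swaps S x \<le> t \<longleftrightarrow> x \<le> t"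
  using assms by (auto simp: adjacent_swaps_def) (metis le_antisym not_less_eq_eq)+

lemma adjacent_swaps_bij_betw_atMost:
  assumes "\<And>t. t \<in> S \<Longrightarrow> Suc t \<notin> S" and "t \<notin> S"
  shows "bij_betw (adjacent_swaps S) {..t} {..t}"
  by (rule bij_betw_byWitness[where f' = "adjacent_swaps S"])
    (use adjacent_swaps_involution[OF assms(1)] adjacent_swaps_le_iff[OF assms] in auto)

lemma simple_transp_comp_adjacent_swaps:
  assumes "i \<notin> S" and "Suc i \<notin> S" and "i \<notin> Suc ` S"
  shows "simple_transp i \<circ> adjacent_swaps S = adjacent_swaps (insert i S)"
proof
  fix x
  show "(simple_transp i \<circ> adjacent_swaps S) x = adjacent_swaps (insert i S) x"
  proof (cases "x = i \<or> x = Suc i")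
    case True
    then show ?thesis
      using assms by (auto simp: adjacent_swaps_def simple_transp_def)
  next
    case False
    then have "adjacent_swaps S x \<noteq> i" "adjacent_swaps S x \<noteq> Suc i"
      using assms by (auto simp: adjacent_swaps_def)
    then show ?thesis
      using False by (auto simp: adjacent_swaps_def simple_transp_def)
  qed
qed

lemma simple_transp_commute_imp_not_adjacent:
  assumes "simple_transp i \<circ> simple_transp j = simple_transp j \<circ> simple_transp i"
  shows "j \<noteq> Suc i"
proof
  assume "j = Suc i"
  with fun_cong[OF assms, of i] show False
    by (simp add: simple_transp_def transpose_def)
qed

lemma prod_simple_transp_eq_adjacent_swaps:
  assumes "\<And>i. i \<in> set idx \<Longrightarrow> Suc i \<notin> set idx"
  obtains S where "S \<subseteq> set idx"
    and "foldr (\<circ>) (map simple_transp idx) id = adjacent_swaps S"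
proof -
  have "\<exists>S\<subseteq>set idx. foldr (\<circ>) (map simple_transp idx) id = adjacent_swaps S"
    using assms
  proof (induction idx)
    case Nil
    then show ?case by (auto simp: adjacent_swaps_def fun_eq_iff)
  next
    case (Cons i idx)
    have "\<exists>S\<subseteq>set idx. foldr (\<circ>) (map simple_transp idx) id = adjacent_swaps S"
      using Cons.prems by (intro Cons.IH) auto
    then obtain S where S: "S \<subseteq> set idx"
      and eq: "foldr (\<circ>) (map simple_transp idx) id = adjacent_swaps S" by blast
    have na: "\<And>t. t \<in> insert i S \<Longrightarrow> Suc t \<notin> insert i S"
      using Cons.prems S by (metis insert_iff list.set(2) subsetD)
    \<comment> \<open>A repeated transposition cancels, so \<open>S\<close> ends up as the indices of odd multiplicity.\<close>
    define T where "T = (if i \<in> S then S - {i} else insert i S)"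
    have "simple_transp i \<circ> adjacent_swaps S = adjacent_swaps T"
    proof (cases "i \<in> S")
      case True
      have "adjacent_swaps S = simple_transp i \<circ> adjacent_swaps (S - {i})"
        using True na by (subst simple_transp_comp_adjacent_swaps) (auto simp: insert_absorb)
      then show ?thesis
        using True by (simp add: T_def fun_eq_iff simple_transp_def)
    next
      case False
      then show ?thesis
        using na by (subst simple_transp_comp_adjacent_swaps) (auto simp: T_def)
    qed
    then have "foldr (\<circ>) (map simple_transp (i # idx)) id = adjacent_swaps T"
      by (simp add: eq)
    moreover have "T \<subseteq> set (i # idx)" using S by (auto simp: T_def)
    ultimately show ?case by blast
  qed
  then show thesis using that by blast
qed

text \<open>
  Neither neighbour of \<open>t\<close> is in \<open>S\<close>, so the swaps permute the prefix of length \<open>t - 1\<close> and the prefix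
  sums at \<open>t\<close> differ exactly by \<open>\<tau> (t + 1) - \<tau> t\<close>.
\<close>

lemma bruhat_le_adjacent_swaps_imp_less:
  assumes S: "\<And>t. t \<in> S \<Longrightarrow> 0 < t \<and> Suc t \<notin> S"
    and le: "bruhat_le n \<tau> (\<tau> \<circ> adjacent_swaps S)" and "inj \<tau>" and t: "t \<in> S"
  shows "\<tau> t < \<tau> (Suc t)"
proof -
  obtain r where r: "t = Suc r" using S[OF t] by (cases t) auto
  have "r \<notin> S" using S t r by auto
  then have bij: "bij_betw (adjacent_swaps S) {..r} {..r}"
    using S by (intro adjacent_swaps_bij_betw_atMost) auto
  have "(\<Sum>x\<le>t. \<tau> x) \<le> (\<Sum>x\<le>t. \<tau> (adjacent_swaps S x))"
    using bruhat_le_prefix_sum_mono[OF le, of t] by simp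
  moreover have "(\<Sum>x\<le>r. \<tau> (adjacent_swaps S x)) = (\<Sum>x\<le>r. \<tau> x)"
    using sum.reindex_bij_betw[OF bij, of \<tau>] .
  moreover have "adjacent_swaps S t = Suc t" using t by (simp add: adjacent_swaps_def)
  ultimately have "\<tau> t \<le> \<tau> (Suc t)" by (simp add: r)
  moreover have "\<tau> t \<noteq> \<tau> (Suc t)" using \<open>inj \<tau>\<close> by (simp add: inj_eq)
  ultimately show ?thesis by simp
qed

section \<open>Gale intervals of commuting transpositions\<close>

theorem proposition36:
  fixes n :: nat and \<tau> \<tau>' :: "nat \<Rightarrow> nat" and idx :: "nat list" and Bs Bs' :: "nat set list"
  assumes "\<tau> permutes {1..n}" and "\<tau>' permutes {1..n}"
    and "bruhat_le n \<tau> \<tau>'"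
    and "set idx \<subseteq> {1..<n}"
    and "\<tau>' = \<tau> \<circ> foldr (\<circ>) (map simple_transp idx) id"
    and "Bs \<in> flags_of_bases (uniform_flag n)" and "bruhat_perm n Bs = \<tau>"
    and "Bs' \<in> flags_of_bases (uniform_flag n)" and "bruhat_perm n Bs' = \<tau>'"
    and "\<forall>i\<in>set idx. \<forall>j\<in>set idx.
           simple_transp i \<circ> simple_transp j = simple_transp j \<circ> simple_transp i"
  shows "\<exists>Ms. is_lpfm n Ms \<and> gale_interval n Bs' Bs = flags_of_bases Ms"
proof -
  note Bs = assms(6) and Bs' = assms(8)
  have "\<And>i. i \<in> set idx \<Longrightarrow> Suc i \<notin> set idx"
    using assms(10) simple_transp_commute_imp_not_adjacent by blast
  then obtain S where S_sub: "S \<subseteq> set idx"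
    and prod: "foldr (\<circ>) (map simple_transp idx) id = adjacent_swaps S"
    and na: "\<And>t. t \<in> S \<Longrightarrow> Suc t \<notin> S"
    by (metis prod_simple_transp_eq_adjacent_swaps subsetD)
  have S: "0 < t \<and> t < n \<and> Suc t \<notin> S" if "t \<in> S" for t
    using S_sub assms(4) na that by fastforce
  have S0: "0 \<notin> S" and finS: "finite S" and nS: "n \<notin> S"
    using S[of 0] S[of n] finite_subset[OF S_sub] by auto
  have \<tau>': "\<tau>' = \<tau> \<circ> adjacent_swaps S" using assms(5) prod by simp
  have asc: "\<tau> t < \<tau> (Suc t)" if "t \<in> S" for t
    using bruhat_le_adjacent_swaps_imp_less[OF _ _ permutes_inj[OF assms(1)] that] S assms(3) \<tau>'
    by blast
  \<comment> \<open>The flag of \<open>\<tau>'\<close> is the flag of \<open>\<tau>\<close> with the pairs exchanged.\<close>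
  have swap_range: "adjacent_swaps S x \<in> {1..n} \<longleftrightarrow> x \<in> {1..n}" for x
    using adjacent_swaps_le_iff[OF na S0, of x] adjacent_swaps_le_iff[OF na nS, of x] by auto
  have mem': "x \<in> Bs' ! k \<longleftrightarrow> adjacent_swaps S x \<in> Bs ! k" if "k \<le> n" for x k
  proof (cases "x \<in> {1..n}")
    case True
    then show ?thesis
      using flag_mem_iff_bruhat_perm[OF Bs' True that] swap_range[of x]
        flag_mem_iff_bruhat_perm[OF Bs, of "adjacent_swaps S x" k] that
      by (simp add: assms(7,9) \<tau>')
  next
    case False
    then show ?thesis
      using uniform_flagD(2)[OF Bs that] uniform_flagD(2)[OF Bs' that] swap_range[of x]
      by (auto simp: uniform_def)
  qed
  \<comment> \<open>Large values of \<open>\<tau>\<close> belong to elements that enter the flag early.\<close>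
  have late: "Suc t \<in> Bs ! k" if "t \<in> S" "t \<in> Bs ! k" "k \<le> n" for t k
    using flag_mem_iff_bruhat_perm[OF Bs, of t k] flag_mem_iff_bruhat_perm[OF Bs, of "Suc t" k]
      S[OF that(1)] asc[OF that(1)] that assms(7) by auto
  have lpm_eq: "lpm k n (Bs' ! k) (Bs ! k) = prefix_class n S (Bs ! k)" if k: "k \<le> n" for k
  proof (rule lpm_eq_prefix_class)
    fix t assume t: "t \<notin> S"
    have "bij_betw (adjacent_swaps S) (Bs' ! k \<inter> {..t}) (Bs ! k \<inter> {..t})"
      by (rule bij_betw_byWitness[where f' = "adjacent_swaps S"])
        (use adjacent_swaps_involution[OF na] adjacent_swaps_le_iff[OF na t] mem'[OF k] in auto)
    then show "card (Bs' ! k \<inter> {..t}) = card (Bs ! k \<inter> {..t})"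
      by (rule bij_betw_same_card)
  next
    fix t assume t: "t \<in> S" "Suc t \<in> Bs' ! k"
    then have "t \<in> Bs ! k" using mem'[OF k, of "Suc t"] na by (simp add: adjacent_swaps_def)
    then show "t \<in> Bs' ! k"
      using mem'[OF k, of t] late[OF t(1) _ k] t(1) by (simp add: adjacent_swaps_def)
  qed (use S uniform_flagD(2)[OF Bs k] uniform_flagD(2)[OF Bs' k] late k in auto)

  define M where "M k = lpm k n (Bs' ! k) (Bs ! k)" for k
  define Ms where "Ms = map M [0..<n + 1]"
  have Bs_in_M: "Bs ! k \<in> M k" if "k \<le> n" for k
    using uniform_flagD(2)[OF Bs that]
    by (simp add: M_def lpm_eq[OF that] prefix_class_def uniform_def)
  have "inj_on M {0..<n + 1}"
  proof (rule inj_onI)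
    fix j k assume "j \<in> {0..<n + 1}" "k \<in> {0..<n + 1}" "M j = M k"
    then have "Bs ! j \<in> M k" "Bs ! j \<in> uniform j n"
      using Bs_in_M[of j] uniform_flagD(2)[OF Bs, of j] by auto
    then show "j = k" by (auto simp: M_def lpm_def uniform_def)
  qed
  then have "distinct Ms" by (simp add: Ms_def distinct_map del: upt_Suc)
  moreover have "is_lpm n (M k)" if "k \<le> n" for k
    using Bs_in_M[OF that] uniform_flagD(2)[OF Bs that] uniform_flagD(2)[OF Bs' that]
    unfolding is_lpm_def M_def by (auto simp: lpm_def)
  moreover have "quotient_of n (M k) (M (Suc k))" if k: "k < n" for k
  proof -
    obtain x where x: "x \<in> {1..n}" "x \<notin> Bs ! k" "Bs ! Suc k = insert x (Bs ! k)"
      using uniform_flag_step[OF Bs k] .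
    have "finite (Bs ! k)"
      using uniform_flagD(2)[OF Bs, of k] k by (auto simp: uniform_def intro: finite_subset)
    then show ?thesis
      using prefix_class_quotient[OF finS S0, of "Bs ! k" x n] x k lpm_eq[of k] lpm_eq[of "Suc k"]
      by (simp add: M_def)
  qed
  ultimately have "is_lpfm n Ms"
    by (auto simp: is_lpfm_def Ms_def successively_conv_nth simp del: upt_Suc)
  moreover have "gale_interval n Bs' Bs = flags_of_bases Ms"
  proof -
    have len: "length Ms = Suc n" "length (uniform_flag n) = Suc n"
      by (simp_all add: Ms_def uniform_flag_def)
    have "Ms ! k = lpm k n (Bs' ! k) (Bs ! k)" "uniform_flag n ! k = uniform k n"
      if "k < Suc n" for k
      using that by (simp_all add: Ms_def M_def uniform_flag_def del: upt_Suc)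
    then have mem: "C \<in> Ms ! k \<longleftrightarrow> C \<in> uniform_flag n ! k \<and> gale_le (Bs' ! k) C \<and> gale_le C (Bs ! k)"
      if "k < Suc n" for k C
      unfolding lpm_def using that by simp
    have "list_all2 (\<in>) Cs (uniform_flag n) \<and> list_all2 gale_le Bs' Cs \<and> list_all2 gale_le Cs Bs
        \<longleftrightarrow> list_all2 (\<in>) Cs Ms" for Cs
      unfolding list_all2_conv_all_nth len uniform_flagD(1)[OF Bs] uniform_flagD(1)[OF Bs']
      using mem by metis
    then show ?thesis
      unfolding gale_interval_def flags_of_bases_def gale_flag_le_def by blast
  qed
  ultimately show ?thesis by blast
qed

end
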